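(* Let $\rho$ be a Borel probability measure on $\mathbb{R}^2$ whose support is a finite union of line segments. Let $L$ be a straight line through the origin in $\mathbb{R}^2$, let $u$ be a unit vector along $L$, and suppose that the orthogonal projection $\pi_L$ onto $L$ is one-to-one $\rho$-almost everywhere. Let $\Lambda\subseteq\mathbb{R}$. Then $\Lambda u = \{\lambda u : \lambda\in\Lambda\}\subseteq L$ is a spectrum of $\rho$ if and only if $\Lambda$ is a spectrum of the projection measure $\pi_L\rho$ on $\mathbb{R}$.
   Context: The projection $\pi_L:\mathbb{R}^2\to\mathbb{R}$ takes values in $\mathbb{R}$: $\pi_L(v)=s$ whenever $v\in su+u^\perp$, i.e. $\pi_L(v)=u\cdot v$, where $u^\perp$ is the line through the origin orthogonal to $u$. One-to-one $\rho$-almost everywhere means that there is a Borel set of full $\rho$-measure on which $\pi_L$ is injective. The projection measure $\pi_L\rho$ is the Borel measure on $\mathbb{R}$ given by $\pi_L\rho(E)=\rho(Eu+u^\perp)$ for Borel $E\subseteq\mathbb{R}$ (the push-forward of $\rho$ under $\pi_L$). For a compactly supported Borel probability measure $\nu$ on $\mathbb{R}^d$, a countable set $M\subset\mathbb{R}^d$ is a spectrum of $\nu$ if the family of exponentials $e_m(x)=e^{2\pi i m\cdot x}$, $m\in M$, is an orthogonal basis of $L^2(\nu)$ (i.e. $e_m$, $e_{m'}$ are orthogonal in $L^2(\nu)$ for distinct $m,m'\in M$, and the linear span is dense). *)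

theory Defs
  imports "HOL-Probability.Probability"
begin

definition measure_support :: "'a::topological_space measure \<Rightarrow> 'a set" where
  "measure_support \<nu> = {x. \<forall>U. open U \<and> x \<in> U \<longrightarrow> emeasure \<nu> U > 0}"

definition finite_union_of_segments :: "'a::real_vector set \<Rightarrow> bool" where
  "finite_union_of_segments A \<longleftrightarrow>
     (\<exists>\<S>. finite \<S> \<and> (\<forall>S\<in>\<S>. \<exists>a b. S = closed_segment a b) \<and> A = \<Union>\<S>)"

text \<open>
  Functions in \<open>L\<^sup>2\<close> are represented by their measurable representatives; in particular
  \<open>L2_norm \<nu> (\<lambda>x. f x - g x) = 0\<close> just means that \<open>f\<close> and \<open>g\<close> agree \<open>\<nu>\<close>-almost everywhere.
  The integrals in \<open>L2_norm\<close> and \<open>L2_inner\<close> are Bochner integrals, hence meaningful only for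
  arguments satisfying \<open>in_L2 \<nu>\<close>.
\<close>

definition in_L2 :: "'a measure \<Rightarrow> ('a \<Rightarrow> complex) \<Rightarrow> bool" where
  "in_L2 \<nu> f \<longleftrightarrow> f \<in> borel_measurable \<nu> \<and> integrable \<nu> (\<lambda>x. (cmod (f x))\<^sup>2)"

definition L2_inner :: "'a measure \<Rightarrow> ('a \<Rightarrow> complex) \<Rightarrow> ('a \<Rightarrow> complex) \<Rightarrow> complex" where
  "L2_inner \<nu> f g = (LINT x|\<nu>. f x * cnj (g x))"

definition L2_norm :: "'a measure \<Rightarrow> ('a \<Rightarrow> complex) \<Rightarrow> real" where
  "L2_norm \<nu> f = sqrt (LINT x|\<nu>. (cmod (f x))\<^sup>2)"

definition exponential :: "'a::euclidean_space \<Rightarrow> 'a \<Rightarrow> complex" where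
  "exponential m x = exp (2 * of_real pi * \<i> * of_real (m \<bullet> x))"

definition exponential_span :: "'a::euclidean_space set \<Rightarrow> ('a \<Rightarrow> complex) set" where
  "exponential_span M =
     {g. \<exists>F c. finite F \<and> F \<subseteq> M \<and> g = (\<lambda>x. \<Sum>m\<in>F. c m * exponential m x)}"

definition L2_dense :: "'a measure \<Rightarrow> ('a \<Rightarrow> complex) set \<Rightarrow> bool" where
  "L2_dense \<nu> G \<longleftrightarrow>
     (\<forall>f. in_L2 \<nu> f \<longrightarrow> (\<forall>\<epsilon>>0. \<exists>g\<in>G. in_L2 \<nu> g \<and> L2_norm \<nu> (\<lambda>x. f x - g x) < \<epsilon>))"

definition is_spectrum :: "'a::euclidean_space measure \<Rightarrow> 'a set \<Rightarrow> bool" where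
  "is_spectrum \<nu> M \<longleftrightarrow>
     countable M \<and>
     (\<forall>m\<in>M. \<forall>m'\<in>M. m \<noteq> m' \<longrightarrow> L2_inner \<nu> (exponential m) (exponential m') = 0) \<and>
     L2_dense \<nu> (exponential_span M)"

text \<open>
  The orthogonal projection onto the line through the origin spanned by the unit vector \<open>u\<close>,
  with the line identified with the real numbers via \<open>s \<mapsto> s u\<close>.
\<close>

definition line_proj :: "'a::euclidean_space \<Rightarrow> 'a \<Rightarrow> real" where
  "line_proj u v = u \<bullet> v"

definition proj_measure :: "'a::euclidean_space \<Rightarrow> 'a measure \<Rightarrow> real measure" where
  "proj_measure u \<rho> = distr \<rho> borel (line_proj u)"

definition one_to_one_ae :: "'a measure \<Rightarrow> ('a \<Rightarrow> 'b) \<Rightarrow> bool" where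
  "one_to_one_ae \<rho> f \<longleftrightarrow>
     (\<exists>B\<in>sets \<rho>. emeasure \<rho> B = emeasure \<rho> (space \<rho>) \<and> inj_on f B)"

lemma line_proj_eq_iff:
  assumes "norm u = 1"
  shows "line_proj u v = s \<longleftrightarrow> (\<exists>w. u \<bullet> w = 0 \<and> v = s *\<^sub>R u + w)"
proof
  assume "line_proj u v = s"
  then have "u \<bullet> (v - s *\<^sub>R u) = 0"
    using assms by (simp add: line_proj_def inner_diff_right dot_square_norm)
  then show "\<exists>w. u \<bullet> w = 0 \<and> v = s *\<^sub>R u + w"
    by (intro exI[of _ "v - s *\<^sub>R u"]) simp
qed (use assms in \<open>auto simp: line_proj_def inner_add_right dot_square_norm\<close>)

lemma emeasure_proj_measure:
  assumes "sets \<rho> = sets borel" "norm u = 1" "E \<in> sets borel"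
  shows "emeasure (proj_measure u \<rho>) E = emeasure \<rho> {s *\<^sub>R u + w | s w. s \<in> E \<and> u \<bullet> w = 0}"
proof -
  have "line_proj u \<in> borel_measurable \<rho>"
    unfolding line_proj_def measurable_cong_sets[OF assms(1) refl] by measurable
  moreover have "space \<rho> = UNIV"
    using sets_eq_imp_space_eq[OF assms(1)] by simp
  moreover have "line_proj u -` E = {s *\<^sub>R u + w | s w. s \<in> E \<and> u \<bullet> w = 0}"
    using line_proj_eq_iff[OF assms(2)] by blast
  ultimately show ?thesis
    using assms(3) by (simp add: proj_measure_def emeasure_distr)
qed

end

theory Submission
  imports Defs
begin

text \<open>
  Since \<open>exponential (t u)\<close> is \<open>exponential t\<close> composed with the projection, composition with
  the projection is an isometry from \<open>L\<^sup>2\<close> of the projected measure into \<open>L\<^sup>2(\<rho>)\<close> that matches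
  the two families of exponentials. It is onto because the projection has a Borel inverse almost
  everywhere: by inner regularity a full-measure set of injectivity may be taken to be
  \<open>\<sigma>\<close>-compact, and then closed subsets of it have \<open>\<sigma>\<close>-compact, hence Borel, images.
\<close>

section \<open>Compact exhaustion and Borel left inverses\<close>

text \<open>Inner regularity gives compact subsets of \<open>B\<close> that miss at most
  \<open>1 / Suc n\<close> of its measure; their union then misses nothing. A continuous map sends
  such a union to a countable union of compact sets, which cannot be said of an arbitrary Borel set
  \<open>B\<close>.\<close>

lemma full_measure_sigma_compact_subset:
  fixes M :: "'a::{second_countable_topology, complete_space} measure"
  assumes "finite_measure M" and sets_M: "sets M = sets borel" and B: "B \<in> sets M"
    and full: "emeasure M B = emeasure M (space M)"
  obtains K :: "nat \<Rightarrow> 'a set"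
  where "\<And>n. compact (K n)" "(\<Union>n. K n) \<subseteq> B" "AE x in M. x \<in> (\<Union>n. K n)"
proof -
  interpret finite_measure M by fact
  have "\<exists>K. compact K \<and> K \<subseteq> B \<and> emeasure M B \<le> emeasure M K + ennreal (1 / Suc n)" for n
  \<comment> \<open>The supremum argument below needs a number strictly below
    \<open>emeasure M B\<close>, which \<open>ennreal\<close> offers only when this measure is
    positive.\<close>
  proof (cases "emeasure M B = 0")
    case True
    then show ?thesis by (intro exI[of _ "{}"]) auto
  next
    case False
    have SUP: "emeasure M B = (SUP K \<in> {K. K \<subseteq> B \<and> compact K}. emeasure M K)"
      using B sets_M by (intro inner_regular) (auto simp: emeasure_finite)
    have "emeasure M B - ennreal (1 / Suc n) < emeasure M B"
      using False by (intro ennreal_between) (auto simp: zero_less_iff_neq_zero less_top[symmetric])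
    also note SUP
    finally obtain K where "K \<subseteq> B" "compact K" "emeasure M B - ennreal (1 / Suc n) < emeasure M K"
      unfolding less_SUP_iff by blast
    then show ?thesis
      by (intro exI[of _ K]) (auto simp: ennreal_minus_le_iff add.commute dest!: less_imp_le)
  qed
  then obtain K where K: "\<And>n. compact (K n)" "\<And>n. K n \<subseteq> B"
    and le: "\<And>n. emeasure M B \<le> emeasure M (K n) + ennreal (1 / Suc n)"
    by metis
  have K_sets: "K n \<in> sets M" for n
    using K(1) sets_M by (simp add: borel_compact)
  have "emeasure M (space M) \<le> emeasure M (\<Union>n. K n) + ennreal (1 / Suc n)" for n
  proof -
    have "emeasure M (K n) \<le> emeasure M (\<Union>n. K n)"
      using K_sets by (intro emeasure_mono) auto
    then show ?thesis
      using le[of n] full by (metis add_right_mono order_trans)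
  qed
  \<comment> \<open>The bound just shown holds for every \<open>n\<close>, so the error term
    disappears in the limit.\<close>
  moreover have "(\<lambda>n. emeasure M (\<Union>n. K n) + ennreal (1 / Suc n))
      \<longlonglongrightarrow> emeasure M (\<Union>n. K n) + ennreal 0"
    by (rule tendsto_add[OF tendsto_const tendsto_ennrealI[OF LIMSEQ_Suc[OF lim_1_over_n]]])
  ultimately have "emeasure M (space M) \<le> emeasure M (\<Union>n. K n) + ennreal 0"
    by (intro LIMSEQ_le_const) auto
  moreover have "(\<Union>n. K n) \<in> sets M"
    using K_sets by auto
  ultimately have "emeasure M (space M - (\<Union>n. K n)) = 0"
    by (simp add: emeasure_compl diff_eq_0_ennreal less_top[symmetric])
  then have "AE x in M. x \<in> (\<Union>n. K n)"
    using K_sets by (intro AE_I[of _ _ "space M - (\<Union>n. K n)"]) auto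
  with K show thesis by (intro that[of K]) auto
qed

text \<open>On a sigma-compact set of full measure where \<open>p\<close> is injective, the
  set-theoretic inverse is already Borel: the preimage of a closed set under it is the image under
  \<open>p\<close> of a countable union of compact sets, and compact sets are closed in a Hausdorff
  space.\<close>

lemma one_to_one_ae_borel_left_inverse:
  fixes M :: "'a::{second_countable_topology, complete_space} measure"
    and p :: "'a \<Rightarrow> 'b::t2_space"
  assumes "finite_measure M" "sets M = sets borel" and p: "continuous_on UNIV p"
    and "one_to_one_ae M p"
  obtains q where "q \<in> borel \<rightarrow>\<^sub>M borel" "AE x in M. q (p x) = x"
proof -
  from assms(4) obtain B where B: "B \<in> sets M" "emeasure M B = emeasure M (space M)"
    and inj: "inj_on p B"
    by (auto simp: one_to_one_ae_def)
  obtain K :: "nat \<Rightarrow> 'a set" where K: "\<And>n. compact (K n)" "(\<Union>n. K n) \<subseteq> B"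
    and ae: "AE x in M. x \<in> (\<Union>n. K n)"
    using full_measure_sigma_compact_subset[OF assms(1,2) B] by metis
  have inj_K: "inj_on p (\<Union>n. K n)"
    using inj K(2) by (rule inj_on_subset)
  define S where "S = p ` (\<Union>n. K n)"
  define q where "q y = (if y \<in> S then inv_into (\<Union>n. K n) p y else undefined)" for y
  have qp: "q (p x) = x" if "x \<in> (\<Union>n. K n)" for x
    using that inv_into_f_f[OF inj_K that] by (auto simp: q_def S_def)
  have image_sets: "p ` (C \<inter> (\<Union>n. K n)) \<in> sets borel" if "closed C" for C
  proof -
    have "compact (p ` (C \<inter> K n))" for n
      by (intro compact_continuous_image closed_Int_compact that K continuous_on_subset[OF p]) auto
    then have "(\<Union>n. p ` (C \<inter> K n)) \<in> sets borel"
      by (intro sets.countable_UN) (auto simp: borel_compact)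
    moreover have "p ` (C \<inter> (\<Union>n. K n)) = (\<Union>n. p ` (C \<inter> K n))"
      by auto
    ultimately show ?thesis by simp
  qed
  have S: "S \<in> sets borel"
    using image_sets[of UNIV] by (simp add: S_def)
  have "q \<in> borel \<rightarrow>\<^sub>M borel"
  \<comment> \<open>Closed sets are the right generators, since \<open>image_sets\<close> controls
    exactly their traces on the compact union.\<close>
  proof (rule measurable_sigma_sets[of borel UNIV "Collect closed"])
    show "sets borel = sigma_sets UNIV (Collect closed :: 'a set set)"
      by (subst borel_eq_closed) simp
    fix C :: "'a set" assume "C \<in> Collect closed"
    then have C: "closed C" by simp
    \<comment> \<open>Off \<open>S\<close> the function \<open>q\<close> is constant with value
      \<open>undefined\<close>, so \<open>- S\<close> lies entirely inside or entirely outside the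
      preimage.\<close>
    have "q -` C \<inter> space borel =
        p ` (C \<inter> (\<Union>n. K n)) \<union> (if undefined \<in> C then - S else {})"
    proof -
      have "q y \<in> C \<longleftrightarrow> y \<in> p ` (C \<inter> (\<Union>n. K n))" if "y \<in> S" for y
      proof -
        from that obtain x where x: "x \<in> (\<Union>n. K n)" "y = p x"
          unfolding S_def by blast
        show ?thesis
          using inj_on_image_mem_iff[OF inj_K x(1), of "C \<inter> (\<Union>n. K n)"] qp[OF x(1)] x
          by auto
      qed
      moreover have "q y = undefined" "y \<notin> p ` (C \<inter> (\<Union>n. K n))" if "y \<notin> S" for y
        using that by (auto simp: q_def S_def)
      moreover have "p ` (C \<inter> (\<Union>n. K n)) \<subseteq> S"
        by (auto simp: S_def)
      ultimately show ?thesis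
        by (intro set_eqI, rename_tac y, case_tac "y \<in> S") auto
    qed
    then show "q -` C \<inter> space borel \<in> sets borel"
      using image_sets[OF C] S by (auto simp: Compl_eq_Diff_UNIV)
  qed auto
  moreover have "AE x in M. q (p x) = x"
    using ae qp by (auto elim!: eventually_mono)
  ultimately show thesis by (rule that)
qed

section \<open>Square-integrable functions under push-forward\<close>

lemma in_L2_distr_iff:
  assumes "p \<in> M \<rightarrow>\<^sub>M N" "f \<in> borel_measurable N"
  shows "in_L2 (distr M N p) f \<longleftrightarrow> in_L2 M (f \<circ> p)"
  using assms measurable_comp[OF assms]
  by (simp add: in_L2_def integrable_distr_eq)

lemma L2_norm_distr:
  assumes "p \<in> M \<rightarrow>\<^sub>M N" "f \<in> borel_measurable N"
  shows "L2_norm (distr M N p) f = L2_norm M (f \<circ> p)"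
  using assms by (simp add: L2_norm_def integral_distr)

lemma L2_inner_distr:
  assumes "p \<in> M \<rightarrow>\<^sub>M N" "f \<in> borel_measurable N" "g \<in> borel_measurable N"
  shows "L2_inner (distr M N p) f g = L2_inner M (f \<circ> p) (g \<circ> p)"
proof -
  have "cnj \<in> borel_measurable borel"
    by (intro borel_measurable_continuous_onI continuous_intros)
  then have [measurable]: "(\<lambda>y. cnj (g y)) \<in> borel_measurable N"
    using assms(3) by (rule measurable_compose_rev)
  show ?thesis
    unfolding L2_inner_def using assms(1,2) by (subst integral_distr) auto
qed

text \<open>Composition with \<open>p\<close> preserves the norm, and it is onto up to null sets
  because \<open>f\<close> agrees almost everywhere with \<open>(f \<circ> q) \<circ> p\<close>.
  Density passes through such a map in both directions.\<close>

lemma L2_dense_distr_iff: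
  assumes p [measurable]: "p \<in> M \<rightarrow>\<^sub>M N" and q [measurable]: "q \<in> N \<rightarrow>\<^sub>M M"
    and qp: "AE x in M. q (p x) = x" and G: "G \<subseteq> borel_measurable N"
  shows "L2_dense (distr M N p) G \<longleftrightarrow> L2_dense M ((\<lambda>g. g \<circ> p) ` G)"
proof
  assume dense: "L2_dense (distr M N p) G"
  show "L2_dense M ((\<lambda>g. g \<circ> p) ` G)"
    unfolding L2_dense_def
  proof (intro allI impI)
    fix f and \<epsilon> :: real assume f: "in_L2 M f" and "\<epsilon> > 0"
    then have f_meas [measurable]: "f \<in> borel_measurable M"
      by (simp add: in_L2_def)
    \<comment> \<open>The function to approximate downstairs is \<open>f \<circ> q\<close>; it is
      square integrable there because its pull-back along \<open>p\<close> is \<open>f\<close>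
      almost everywhere.\<close>
    have "integrable M (\<lambda>x. (cmod (f (q (p x))))\<^sup>2) \<longleftrightarrow> integrable M (\<lambda>x. (cmod (f x))\<^sup>2)"
      using qp by (intro integrable_cong_AE) (auto elim!: eventually_mono)
    then have "in_L2 (distr M N p) (f \<circ> q)"
      using f by (subst in_L2_distr_iff) (auto simp: in_L2_def comp_def)
    then obtain g where "g \<in> G" and g: "in_L2 (distr M N p) g"
      and less: "L2_norm (distr M N p) (\<lambda>y. (f \<circ> q) y - g y) < \<epsilon>"
      using dense \<open>\<epsilon> > 0\<close> unfolding L2_dense_def by blast
    have g_meas [measurable]: "g \<in> borel_measurable N"
      using G \<open>g \<in> G\<close> by auto
    have "L2_norm (distr M N p) (\<lambda>y. (f \<circ> q) y - g y) = L2_norm M (\<lambda>x. f (q (p x)) - g (p x))"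
      by (subst L2_norm_distr) (auto simp: comp_def)
    also have "\<dots> = L2_norm M (\<lambda>x. f x - g (p x))"
      unfolding L2_norm_def using qp
      by (intro arg_cong[where f = sqrt] integral_cong_AE) (auto elim!: eventually_mono)
    finally have "L2_norm M (\<lambda>x. f x - (g \<circ> p) x) < \<epsilon>"
      using less by simp
    moreover have "in_L2 M (g \<circ> p)"
      using g in_L2_distr_iff[OF p g_meas] by simp
    ultimately show "\<exists>g\<in>(\<lambda>g. g \<circ> p) ` G. in_L2 M g \<and> L2_norm M (\<lambda>x. f x - g x) < \<epsilon>"
      using \<open>g \<in> G\<close> by blast
  qed
next
  assume dense: "L2_dense M ((\<lambda>g. g \<circ> p) ` G)"
  show "L2_dense (distr M N p) G"
    unfolding L2_dense_def
  proof (intro allI impI)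
    fix f and \<epsilon> :: real assume f: "in_L2 (distr M N p) f" and "\<epsilon> > 0"
    then have f_meas [measurable]: "f \<in> borel_measurable N"
      by (simp add: in_L2_def)
    \<comment> \<open>In this direction the pull-back \<open>f \<circ> p\<close> is approximated,
      and the isometry carries the estimate back.\<close>
    have "in_L2 M (f \<circ> p)"
      using f in_L2_distr_iff[OF p f_meas] by simp
    then obtain g where "g \<in> G" and g: "in_L2 M (g \<circ> p)"
      and less: "L2_norm M (\<lambda>x. (f \<circ> p) x - (g \<circ> p) x) < \<epsilon>"
      using dense \<open>\<epsilon> > 0\<close> unfolding L2_dense_def by blast
    have g_meas [measurable]: "g \<in> borel_measurable N"
      using G \<open>g \<in> G\<close> by auto
    have "L2_norm (distr M N p) (\<lambda>y. f y - g y) < \<epsilon>"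
      using less by (subst L2_norm_distr) (auto simp: comp_def)
    moreover have "in_L2 (distr M N p) g"
      using g in_L2_distr_iff[OF p g_meas] by simp
    ultimately show "\<exists>g\<in>G. in_L2 (distr M N p) g \<and> L2_norm (distr M N p) (\<lambda>x. f x - g x) < \<epsilon>"
      using \<open>g \<in> G\<close> by blast
  qed
qed

section \<open>Exponentials with frequencies on a line\<close>

lemma borel_measurable_exponential [measurable]: "exponential m \<in> borel_measurable borel"
  unfolding exponential_def
  by (intro borel_measurable_continuous_onI continuous_intros)

lemma exponential_span_measurable: "exponential_span A \<subseteq> borel_measurable borel"
  by (auto simp: exponential_span_def)

text \<open>The inner product of \<open>t *\<^sub>R u\<close> with \<open>x\<close> is
  \<open>t * (u \<bullet> x)\<close>, and the inner product on the reals is multiplication.\<close>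

lemma exponential_scaleR: "exponential (t *\<^sub>R u) = exponential t \<circ> line_proj u"
  by (simp add: exponential_def line_proj_def fun_eq_iff)

lemma exponential_span_scaleR:
  fixes u :: "'a::euclidean_space"
  assumes "u \<noteq> 0"
  shows "exponential_span ((\<lambda>t. t *\<^sub>R u) ` A) = (\<lambda>g. g \<circ> line_proj u) ` exponential_span A"
    (is "?L = ?R")
proof (intro set_eqI iffI)
  have inj: "inj_on (\<lambda>t. t *\<^sub>R u) F" for F
    using assms by (auto simp: inj_on_def)
  have sum_eq: "(\<Sum>m\<in>(\<lambda>t. t *\<^sub>R u) ` F. c m * exponential m x) =
      (\<Sum>t\<in>F. c (t *\<^sub>R u) * exponential t (line_proj u x))" for F c x
    by (subst sum.reindex[OF inj]) (simp add: exponential_scaleR)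
  fix g
  {
    assume "g \<in> ?L"
    then obtain F' c where F': "finite F'" "F' \<subseteq> (\<lambda>t. t *\<^sub>R u) ` A"
      and g: "g = (\<lambda>x. \<Sum>m\<in>F'. c m * exponential m x)"
      unfolding exponential_span_def by blast
    obtain F where "finite F" "F \<subseteq> A" "F' = (\<lambda>t. t *\<^sub>R u) ` F"
      using finite_subset_image[OF F'] by blast
    with g have "g = (\<lambda>x. \<Sum>m\<in>(\<lambda>t. t *\<^sub>R u) ` F. c m * exponential m x)"
      by simp
    then have "g = (\<lambda>s. \<Sum>t\<in>F. c (t *\<^sub>R u) * exponential t s) \<circ> line_proj u"
      by (simp add: sum_eq fun_eq_iff)
    moreover have "(\<lambda>s. \<Sum>t\<in>F. c (t *\<^sub>R u) * exponential t s) \<in> exponential_span A"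
      unfolding exponential_span_def mem_Collect_eq
      using \<open>finite F\<close> \<open>F \<subseteq> A\<close> by (intro exI[of _ F] exI[of _ "\<lambda>t. c (t *\<^sub>R u)"]) auto
    ultimately show "g \<in> ?R" by (rule image_eqI)
  next
    assume "g \<in> ?R"
    then obtain F c where F: "finite F" "F \<subseteq> A"
      and g: "g = (\<lambda>x. \<Sum>t\<in>F. c t * exponential t (line_proj u x))"
      unfolding exponential_span_def by (auto simp: comp_def)
    \<comment> \<open>Coefficients indexed by reals become coefficients indexed by vectors; only the
      values of \<open>d\<close> at multiples of \<open>u\<close> enter the sum.\<close>
    define d where "d m = c (inv (\<lambda>t. t *\<^sub>R u) m)" for m
    have "d (t *\<^sub>R u) = c t" for t
      using inv_f_f[OF inj, of t] by (simp add: d_def)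
    then have "g = (\<lambda>x. \<Sum>m\<in>(\<lambda>t. t *\<^sub>R u) ` F. d m * exponential m x)"
      by (simp add: g sum_eq)
    then show "g \<in> ?L"
      unfolding exponential_span_def mem_Collect_eq
      using F by (intro exI[of _ "(\<lambda>t. t *\<^sub>R u) ` F"] exI[of _ d]) auto
  }
qed

section \<open>Transfer of spectra\<close>

text \<open>The three clauses of \<open>is_spectrum\<close> match one by one: countability by
  injectivity of scaling \<open>u\<close>, orthogonality by \<open>L2_inner_distr\<close>, density
  by \<open>L2_dense_distr_iff\<close> applied to the Borel left inverse of the projection.\<close>

theorem is_spectrum_proj_measure_iff:
  fixes \<rho> :: "'a::euclidean_space measure"
  assumes "finite_measure \<rho>" and sets: "sets \<rho> = sets borel" and "u \<noteq> 0"
    and "one_to_one_ae \<rho> (line_proj u)"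
  shows "is_spectrum \<rho> ((\<lambda>t. t *\<^sub>R u) ` \<Lambda>) \<longleftrightarrow> is_spectrum (proj_measure u \<rho>) \<Lambda>"
proof -
  have cont: "continuous_on UNIV (line_proj u)"
    unfolding line_proj_def by (intro continuous_intros)
  then have p: "line_proj u \<in> \<rho> \<rightarrow>\<^sub>M borel"
    using borel_measurable_continuous_onI measurable_cong_sets[OF sets refl] by blast
  obtain q :: "real \<Rightarrow> 'a" where "q \<in> borel \<rightarrow>\<^sub>M borel" and qp: "AE x in \<rho>. q (line_proj u x) = x"
    using one_to_one_ae_borel_left_inverse[OF assms(1,2) cont assms(4)] by metis
  then have q: "q \<in> borel \<rightarrow>\<^sub>M \<rho>"
    using measurable_cong_sets[OF refl sets] by blast
  have inj: "inj_on (\<lambda>t. t *\<^sub>R u) \<Lambda>"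
    using \<open>u \<noteq> 0\<close> by (auto simp: inj_on_def)
  have "L2_dense \<rho> (exponential_span ((\<lambda>t. t *\<^sub>R u) ` \<Lambda>)) \<longleftrightarrow>
      L2_dense (proj_measure u \<rho>) (exponential_span \<Lambda>)"
    unfolding exponential_span_scaleR[OF \<open>u \<noteq> 0\<close>] proj_measure_def
    using L2_dense_distr_iff[OF p q qp exponential_span_measurable] by simp
  moreover have "L2_inner \<rho> (exponential (s *\<^sub>R u)) (exponential (t *\<^sub>R u)) =
      L2_inner (proj_measure u \<rho>) (exponential s) (exponential t)" for s t
    by (simp add: exponential_scaleR proj_measure_def L2_inner_distr[OF p])
  \<comment> \<open>Since \<open>u \<noteq> 0\<close>, the vectors \<open>s *\<^sub>R u\<close> and
    \<open>t *\<^sub>R u\<close> are distinct exactly when \<open>s\<close> and \<open>t\<close>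
    are, so both orthogonality clauses range over the same pairs.\<close>
  ultimately show ?thesis
    unfolding is_spectrum_def using \<open>u \<noteq> 0\<close> by (simp add: countable_image_inj_eq[OF inj])
qed

theorem theorem1p2:
  fixes \<rho> :: "(real ^ 2) measure"
    and L :: "(real ^ 2) set"
    and u :: "real ^ 2"
    and \<Lambda> :: "real set"
  assumes "prob_space \<rho>"
    and "sets \<rho> = sets borel"
    and "finite_union_of_segments (measure_support \<rho>)"
    and "subspace L" and "dim L = 1"
    and "u \<in> L" and "norm u = 1"
    and "one_to_one_ae \<rho> (line_proj u)"
  shows "is_spectrum \<rho> {t *\<^sub>R u | t. t \<in> \<Lambda>} \<longleftrightarrow> is_spectrum (proj_measure u \<rho>) \<Lambda>"
proof -
  have "{t *\<^sub>R u | t. t \<in> \<Lambda>} = (\<lambda>t. t *\<^sub>R u) ` \<Lambda>"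
    by auto
  moreover have "u \<noteq> 0"
    using assms(7) by auto
  ultimately show ?thesis
    using is_spectrum_proj_measure_iff[OF prob_space.finite_measure[OF assms(1)] assms(2) _ assms(8)]
    by simp
qed

end
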